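(* Let $X$ be a connected and locally path connected space. Then for every $x\in X$, $\pi_1^{sp}(X,x)$ is a closed subgroup of $\pi_1^{\tau}(X,x)$.
   Context: Spanier group: for an open cover $\mathcal{U}$ of $X$, $\pi(\mathcal{U},x)\le\pi_1(X,x)$ is the subgroup of classes having a representative of the form $\prod_{j=1}^n u_j v_j u_j^{-1}$, with $u_j$ a path starting at $x$ and $v_j$ a loop based at $u_j(1)$ lying inside some $U_j\in\mathcal{U}$. Then $\pi_1^{sp}(X,x)=\bigcap_{\mathcal{U}}\pi(\mathcal{U},x)$ over all open covers $\mathcal{U}$. $\pi_1^{qtop}(X,x)$ is the group $\pi_1(X,x)$ with the quotient topology induced by the natural map $\Omega(X,x)\to\pi_1(X,x)$ from the loop space with the compact-open topology. $\pi_1^{\tau}(X,x)$ (Brazas) is the group $\pi_1(X,x)$ with the finest topology that is coarser than (or equal to) the topology of $\pi_1^{qtop}(X,x)$ and makes $\pi_1(X,x)$ a topological group. *)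

theory Defs
  imports "HOL-Analysis.Analysis" "HOL-Algebra.Group"
begin

section \<open>The fundamental group\<close>

text \<open>A space is a set \<open>X\<close> in a type of class \<open>topological_space\<close>, with the subspace topology
  (\<open>X = UNIV\<close> gives the whole type). As in the library, a path is a function on \<open>real\<close> of which
  only the restriction to \<open>{0..1}\<close> matters: paths that agree on \<open>{0..1}\<close> are homotopic, and they
  lie in the same open sets of the loop space below.\<close>

definition loops :: "'a::topological_space set \<Rightarrow> 'a \<Rightarrow> (real \<Rightarrow> 'a) set" where
  "loops X x = {p. path p \<and> path_image p \<subseteq> X \<and> pathstart p = x \<and> pathfinish p = x}"

definition path_class :: "'a::topological_space set \<Rightarrow> (real \<Rightarrow> 'a) \<Rightarrow> (real \<Rightarrow> 'a) set" where
  "path_class X p = {q. homotopic_paths X p q}"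

definition fundamental_group ::
    "'a::topological_space set \<Rightarrow> 'a \<Rightarrow> (real \<Rightarrow> 'a) set monoid" where
  "fundamental_group X x =
     \<lparr>carrier = path_class X ` loops X x,
      mult = (\<lambda>A B. {r. \<exists>p\<in>A. \<exists>q\<in>B. homotopic_paths X (p +++ q) r}),
      one = path_class X (\<lambda>_. x)\<rparr>"

lemma path_class_eq_iff:
  assumes "path p" "path_image p \<subseteq> X"
  shows "path_class X p = path_class X q \<longleftrightarrow> homotopic_paths X p q"
proof
  assume "path_class X p = path_class X q"
  moreover have "p \<in> path_class X p"
    using assms by (simp add: path_class_def)
  ultimately show "homotopic_paths X p q"
    by (simp add: path_class_def homotopic_paths_sym)
next
  assume "homotopic_paths X p q"
  then show "path_class X p = path_class X q"
    unfolding path_class_def using homotopic_paths_trans homotopic_paths_sym by blast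
qed

lemma loops_join: "p \<in> loops X x \<Longrightarrow> q \<in> loops X x \<Longrightarrow> p +++ q \<in> loops X x"
  by (auto simp: loops_def path_image_join)

lemma loops_reverse: "p \<in> loops X x \<Longrightarrow> reversepath p \<in> loops X x"
  by (auto simp: loops_def)

lemma loops_const: "x \<in> X \<Longrightarrow> (\<lambda>_. x) \<in> loops X x"
  by (auto simp: loops_def path_def path_image_def pathstart_def pathfinish_def)

lemma mult_path_class:
  assumes "p \<in> loops X x" "q \<in> loops X x"
  shows "path_class X p \<otimes>\<^bsub>fundamental_group X x\<^esub> path_class X q = path_class X (p +++ q)"
proof -
  have "homotopic_paths X (p +++ q) r"
    if "homotopic_paths X p p'" "homotopic_paths X q q'" "homotopic_paths X (p' +++ q') r" for p' q' r
  proof -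
    have "homotopic_paths X (p +++ q) (p' +++ q')"
      using that assms by (intro homotopic_paths_join) (auto simp: loops_def)
    then show ?thesis using that(3) by (rule homotopic_paths_trans)
  qed
  moreover have "homotopic_paths X p p" "homotopic_paths X q q"
    using assms by (auto simp: loops_def)
  ultimately have "(\<exists>p'. homotopic_paths X p p' \<and> (\<exists>q'. homotopic_paths X q q' \<and> homotopic_paths X (p' +++ q') r))
      \<longleftrightarrow> homotopic_paths X (p +++ q) r" for r
    by blast
  then show ?thesis
    by (simp add: fundamental_group_def path_class_def)
qed

text \<open>The library has the unit and inverse laws for normed spaces only, because its constant path
  is a \<open>linepath\<close>.\<close>

lemma homotopic_paths_const_right:
  assumes "path p" "path_image p \<subseteq> X" "pathfinish p = x"
  shows "homotopic_paths X (p +++ (\<lambda>_. x)) p"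
proof -
  let ?f = "\<lambda>t::real. min (2 * t) 1"
  have "homotopic_paths X p (p +++ (\<lambda>_. x))"
  proof (rule homotopic_paths_reparametrize[OF assms(1,2), where f = ?f])
    show "continuous_on {0..1} ?f" by (intro continuous_intros)
  qed (use assms(3) in \<open>auto simp: joinpaths_def pathfinish_def min_def\<close>)
  then show ?thesis by (rule homotopic_paths_sym)
qed

lemma homotopic_paths_const_left:
  assumes "path p" "path_image p \<subseteq> X" "pathstart p = x"
  shows "homotopic_paths X ((\<lambda>_. x) +++ p) p"
proof -
  let ?f = "\<lambda>t::real. max (2 * t - 1) 0"
  have "homotopic_paths X p ((\<lambda>_. x) +++ p)"
  proof (rule homotopic_paths_reparametrize[OF assms(1,2), where f = ?f])
    show "continuous_on {0..1} ?f" by (intro continuous_intros)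
  qed (use assms(3) in \<open>auto simp: joinpaths_def pathstart_def max_def\<close>)
  then show ?thesis by (rule homotopic_paths_sym)
qed

lemma homotopic_paths_reverse_left:
  assumes "path p" "path_image p \<subseteq> X" "pathfinish p = x"
  shows "homotopic_paths X (reversepath p +++ p) (\<lambda>_. x)"
proof -
  let ?f = "\<lambda>z::real \<times> real. max (1 - 2 * snd z * (1 - fst z)) (max (fst z) (1 - 2 * (1 - snd z) * (1 - fst z)))"
  have 1: "?f z \<in> {0..1}" if "z \<in> {0..1} \<times> {0..1}" for z
  proof -
    have "0 \<le> 2 * snd z * (1 - fst z)" "0 \<le> 2 * (1 - snd z) * (1 - fst z)"
      using that by (auto intro!: mult_nonneg_nonneg)
    then show ?thesis using that by (auto simp: max_def)
  qed
  have p: "continuous_on {0..1} p" "p ` {0..1} \<subseteq> X" "p 1 = x"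
    using assms by (auto simp: path_def path_image_def pathfinish_def)
  have "continuous_on ({0..1} \<times> {0..1}) (\<lambda>z. p (?f z))"
  proof (rule continuous_on_compose2[OF p(1)])
    show "continuous_on ({0..1} \<times> {0..1}) ?f" by (intro continuous_intros)
  qed (use 1 in blast)
  moreover have "(\<lambda>z. p (?f z)) \<in> {0..1} \<times> {0..1} \<rightarrow> X"
    using 1 p(2) by (intro Pi_I) blast
  moreover have "p (?f (0, t)) = (reversepath p +++ p) t" if "t \<in> {0..1}" for t
  proof (cases "t \<le> 1/2")
    case True
    then have "?f (0, t) = 1 - 2 * t" using that by (auto simp: max_def)
    then show ?thesis using True by (simp add: joinpaths_def reversepath_def)
  next
    case False
    then have "?f (0, t) = 2 * t - 1" using that by (auto simp: max_def)
    then show ?thesis using False by (simp add: joinpaths_def)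
  qed
  moreover have "p (?f (1, t)) = x" for t
    using p(3) by simp
  moreover have "pathstart ((\<lambda>z. p (?f z)) \<circ> Pair t) = x"
       "pathfinish ((\<lambda>z. p (?f z)) \<circ> Pair t) = x" if "t \<in> {0..1}" for t
    using that p(3) by (auto simp: pathstart_def pathfinish_def max_def)
  moreover have "pathstart (reversepath p +++ p) = x" "pathfinish (reversepath p +++ p) = x"
    using assms by auto
  ultimately show ?thesis
    unfolding homotopic_paths by (intro exI[where x = "\<lambda>z. p (?f z)"]) auto
qed

lemma group_fundamental_group:
  assumes "x \<in> X"
  shows "group (fundamental_group X x)"
proof (rule groupI)
  let ?G = "fundamental_group X x"
  have carr: "carrier ?G = path_class X ` loops X x" and one: "\<one>\<^bsub>?G\<^esub> = path_class X (\<lambda>_. x)"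
    by (simp_all add: fundamental_group_def)
  show "A \<otimes>\<^bsub>?G\<^esub> B \<in> carrier ?G" if "A \<in> carrier ?G" "B \<in> carrier ?G" for A B
    using that unfolding carr by (auto simp: mult_path_class loops_join)
  show "\<one>\<^bsub>?G\<^esub> \<in> carrier ?G"
    unfolding carr one using loops_const[OF assms] by blast
  show "A \<otimes>\<^bsub>?G\<^esub> B \<otimes>\<^bsub>?G\<^esub> C = A \<otimes>\<^bsub>?G\<^esub> (B \<otimes>\<^bsub>?G\<^esub> C)"
    if ABC: "A \<in> carrier ?G" "B \<in> carrier ?G" "C \<in> carrier ?G" for A B C
  proof -
    obtain p q r where pqr: "p \<in> loops X x" "q \<in> loops X x" "r \<in> loops X x"
      "A = path_class X p" "B = path_class X q" "C = path_class X r"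
      using ABC unfolding carr by blast
    have "homotopic_paths X (p +++ (q +++ r)) ((p +++ q) +++ r)"
      using pqr(1-3) by (intro homotopic_paths_assoc) (auto simp: loops_def)
    then have "path_class X ((p +++ q) +++ r) = path_class X (p +++ (q +++ r))"
      by (metis path_class_eq_iff homotopic_paths_imp_path homotopic_paths_imp_subset)
    then show ?thesis
      using pqr by (simp add: mult_path_class loops_join)
  qed
  show "\<one>\<^bsub>?G\<^esub> \<otimes>\<^bsub>?G\<^esub> A = A" if A: "A \<in> carrier ?G" for A
  proof -
    obtain p where p: "p \<in> loops X x" "A = path_class X p"
      using A unfolding carr by blast
    have "homotopic_paths X ((\<lambda>_. x) +++ p) p"
      using p by (intro homotopic_paths_const_left) (auto simp: loops_def)
    then have "path_class X ((\<lambda>_. x) +++ p) = path_class X p"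
      using p(1) by (metis path_class_eq_iff homotopic_paths_imp_path homotopic_paths_imp_subset)
    then show ?thesis
      using p loops_const[OF assms] by (simp add: one mult_path_class)
  qed
  show "\<exists>B\<in>carrier ?G. B \<otimes>\<^bsub>?G\<^esub> A = \<one>\<^bsub>?G\<^esub>" if A: "A \<in> carrier ?G" for A
  proof -
    obtain p where p: "p \<in> loops X x" "A = path_class X p"
      using A unfolding carr by blast
    have "homotopic_paths X (reversepath p +++ p) (\<lambda>_. x)"
      using p by (intro homotopic_paths_reverse_left) (auto simp: loops_def)
    then have "path_class X (reversepath p +++ p) = \<one>\<^bsub>?G\<^esub>"
      unfolding one
      by (metis path_class_eq_iff homotopic_paths_imp_path homotopic_paths_imp_subset)
    then have "path_class X (reversepath p) \<otimes>\<^bsub>?G\<^esub> A = \<one>\<^bsub>?G\<^esub>"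
      using p by (simp add: mult_path_class loops_reverse)
    then show ?thesis
      unfolding carr using loops_reverse[OF p(1)] by blast
  qed
qed

section \<open>The Spanier group\<close>

definition open_cover :: "'a::topological_space set \<Rightarrow> 'a set set \<Rightarrow> bool" where
  "open_cover X \<U> \<longleftrightarrow> (\<forall>U\<in>\<U>. openin (top_of_set X) U) \<and> \<Union>\<U> = X"

text \<open>The finite product of paths associates to the right and ends in the constant path at \<open>x\<close>;
  neither choice affects the homotopy class.\<close>

definition spanier_cover :: "'a::topological_space set \<Rightarrow> 'a set set \<Rightarrow> 'a \<Rightarrow> (real \<Rightarrow> 'a) set set" where
  "spanier_cover X \<U> x =
     {A \<in> carrier (fundamental_group X x).
        \<exists>uvs. (\<forall>(u, v)\<in>set uvs.
                  path u \<and> path_image u \<subseteq> X \<and> pathstart u = x \<and>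
                  v \<in> loops X (pathfinish u) \<and> (\<exists>U\<in>\<U>. path_image v \<subseteq> U)) \<and>
              foldr (+++) (map (\<lambda>(u, v). u +++ v +++ reversepath u) uvs) (\<lambda>_. x) \<in> A}"

definition spanier_group :: "'a::topological_space set \<Rightarrow> 'a \<Rightarrow> (real \<Rightarrow> 'a) set set" where
  "spanier_group X x = (\<Inter>\<U>\<in>{\<U>. open_cover X \<U>}. spanier_cover X \<U> x)"

section \<open>The quotient topology on the fundamental group\<close>

definition loop_space :: "'a::topological_space set \<Rightarrow> 'a \<Rightarrow> (real \<Rightarrow> 'a) topology" where
  "loop_space X x =
     topology_generated_by
       {{p \<in> loops X x. p ` K \<subseteq> U} | K U. compact K \<and> K \<subseteq> {0..1} \<and> openin (top_of_set X) U}"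

definition pi1_qtop :: "'a::topological_space set \<Rightarrow> 'a \<Rightarrow> (real \<Rightarrow> 'a) set topology" where
  "pi1_qtop X x =
     topology (\<lambda>W. W \<subseteq> carrier (fundamental_group X x) \<and>
                   openin (loop_space X x) {p \<in> loops X x. path_class X p \<in> W})"

lemma topspace_loop_space: "topspace (loop_space X x) = loops X x"
proof -
  let ?B = "{{p \<in> loops X x. p ` K \<subseteq> U} | K U. compact K \<and> K \<subseteq> {0..1} \<and> openin (top_of_set X) U}"
  have "loops X x = {p \<in> loops X x. p ` {0..1} \<subseteq> X}"
    by (auto simp: loops_def path_image_def)
  moreover have "compact {0..1::real}" "openin (top_of_set X) X" by auto
  ultimately have "loops X x \<in> ?B" by blast
  moreover have "\<Union>?B \<subseteq> loops X x" by blast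
  ultimately show ?thesis
    unfolding loop_space_def topology_generated_by_topspace by (meson Union_upper subset_antisym)
qed

lemma openin_pi1_qtop:
  "openin (pi1_qtop X x) W \<longleftrightarrow>
     W \<subseteq> carrier (fundamental_group X x) \<and>
     openin (loop_space X x) {p \<in> loops X x. path_class X p \<in> W}"
proof -
  have "{p \<in> loops X x. path_class X p \<in> S \<inter> T} =
        {p \<in> loops X x. path_class X p \<in> S} \<inter> {p \<in> loops X x. path_class X p \<in> T}" for S T
    by blast
  moreover have "{p \<in> loops X x. path_class X p \<in> \<Union>\<K>} =
        (\<Union>W\<in>\<K>. {p \<in> loops X x. path_class X p \<in> W})" for \<K>
    by blast
  ultimately have "istopology (\<lambda>W. W \<subseteq> carrier (fundamental_group X x) \<and>
                   openin (loop_space X x) {p \<in> loops X x. path_class X p \<in> W})"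
    unfolding istopology_def by (auto intro!: openin_Union)
  then show ?thesis by (simp add: pi1_qtop_def)
qed

lemma quotient_map_path_class: "quotient_map (loop_space X x) (pi1_qtop X x) (path_class X)"
proof -
  have "{p \<in> loops X x. path_class X p \<in> carrier (fundamental_group X x)} = loops X x"
    by (auto simp: fundamental_group_def)
  then have "openin (pi1_qtop X x) (carrier (fundamental_group X x))"
    using openin_topspace[of "loop_space X x"] by (simp add: openin_pi1_qtop topspace_loop_space)
  then have "topspace (pi1_qtop X x) = carrier (fundamental_group X x)"
    by (metis openin_pi1_qtop openin_topspace openin_subset subset_antisym)
  then show ?thesis
    by (simp add: quotient_map_def topspace_loop_space openin_pi1_qtop) 
       (simp add: fundamental_group_def)
qed

lemma topspace_pi1_qtop: "topspace (pi1_qtop X x) = carrier (fundamental_group X x)"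
  using quotient_imp_surjective_map[OF quotient_map_path_class[of X x]]
  by (simp add: fundamental_group_def topspace_loop_space)

section \<open>Group topologies\<close>

definition topological_group :: "('g, 'm) monoid_scheme \<Rightarrow> 'g topology \<Rightarrow> bool" where
  "topological_group G T \<longleftrightarrow>
     group G \<and> topspace T = carrier G \<and>
     continuous_map (prod_topology T T) T (\<lambda>(a, b). a \<otimes>\<^bsub>G\<^esub> b) \<and>
     continuous_map T T (\<lambda>a. inv\<^bsub>G\<^esub> a)"

definition coarser :: "'g topology \<Rightarrow> 'g topology \<Rightarrow> bool" where
  "coarser T T' \<longleftrightarrow> topspace T = topspace T' \<and> (\<forall>W. openin T W \<longrightarrow> openin T' W)"

definition is_finest_group_topology ::
    "('g, 'm) monoid_scheme \<Rightarrow> 'g topology \<Rightarrow> 'g topology \<Rightarrow> bool" where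
  "is_finest_group_topology G Q T \<longleftrightarrow>
     topological_group G T \<and> coarser T Q \<and>
     (\<forall>T'. topological_group G T' \<and> coarser T' Q \<longrightarrow> coarser T' T)"

definition pi1_tau :: "'a::topological_space set \<Rightarrow> 'a \<Rightarrow> (real \<Rightarrow> 'a) set topology" where
  "pi1_tau X x = (THE T. is_finest_group_topology (fundamental_group X x) (pi1_qtop X x) T)"

lemma ex1_finest_group_topology:
  fixes G :: "('g, 'm) monoid_scheme"
  assumes "group G" "topspace Q = carrier G"
  shows "\<exists>!T. is_finest_group_topology G Q T"
proof (rule ex_ex1I)
  interpret group G by fact
  define F where "F = {T. topological_group G T \<and> coarser T Q}"
  define S where "S = topology_generated_by (\<Union>T\<in>F. {W. openin T W})"
  define I where "I = topology_generated_by {carrier G}"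
  have topI: "topspace I = carrier G"
    by (simp add: I_def)
  have "topological_group G I"
  proof -
    have "continuous_map (prod_topology I I) (topology_generated_by {carrier G}) (\<lambda>(a, b). a \<otimes>\<^bsub>G\<^esub> b)"
      unfolding continuous_on_generated_topo_iff
    proof (intro conjI allI impI)
      have "(\<lambda>(a, b). a \<otimes>\<^bsub>G\<^esub> b) -` carrier G \<inter> topspace (prod_topology I I)
            = topspace (prod_topology I I)"
        by (auto simp: topI)
      then show "openin (prod_topology I I)
          ((\<lambda>(a, b). a \<otimes>\<^bsub>G\<^esub> b) -` U \<inter> topspace (prod_topology I I))" if "U \<in> {carrier G}" for U
        using that openin_topspace by (metis singletonD)
    qed (auto simp: topI)
    moreover have "continuous_map I (topology_generated_by {carrier G}) (\<lambda>a. inv\<^bsub>G\<^esub> a)"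
      unfolding continuous_on_generated_topo_iff
    proof (intro conjI allI impI)
      have "(\<lambda>a. inv\<^bsub>G\<^esub> a) -` carrier G \<inter> topspace I = topspace I"
        by (auto simp: topI)
      then show "openin I ((\<lambda>a. inv\<^bsub>G\<^esub> a) -` U \<inter> topspace I)" if "U \<in> {carrier G}" for U
        using that openin_topspace by (metis singletonD)
    qed (auto simp: topI)
    ultimately show ?thesis
      using assms(1) topI by (simp add: topological_group_def flip: I_def)
  qed
  moreover have "coarser I Q"
  proof -
    have "openin Q W" if "generate_topology_on {carrier G} W" for W
      using that by induction (use openin_topspace[of Q] assms(2) in auto)
    then show ?thesis
      unfolding coarser_def using topI assms(2) by (simp add: I_def openin_topology_generated_by_iff)
  qed
  ultimately have "I \<in> F" by (simp add: F_def)
  have topF: "topspace T = carrier G" if "T \<in> F" for T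
    using that by (simp add: F_def topological_group_def)
  have topS: "topspace S = carrier G"
  proof -
    have "\<Union>(\<Union>T\<in>F. {W. openin T W}) = (\<Union>T\<in>F. topspace T)"
      unfolding topspace_def by blast
    also have "\<dots> = carrier G"
      using topF \<open>I \<in> F\<close> by auto
    finally show ?thesis by (simp add: S_def)
  qed
  have openS: "openin S W" if "T \<in> F" "openin T W" for T W
    unfolding S_def by (rule topology_generated_by_Basis) (use that in blast)
  have FS: "coarser T S" if "T \<in> F" for T
    using that openS topF topS by (simp add: coarser_def)
  have "coarser S Q"
  proof -
    have "openin Q W" if "generate_topology_on (\<Union>T\<in>F. {W. openin T W}) W" for W
      using that by induction (auto simp: F_def coarser_def)
    then show ?thesis
      unfolding coarser_def using topS assms(2) by (simp add: S_def openin_topology_generated_by_iff)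
  qed
  moreover have "topological_group G S"
  proof -
    have idS: "continuous_map S T (\<lambda>a. a)" if "T \<in> F" for T
      unfolding continuous_map_def
    proof (intro conjI allI impI)
      fix U assume U: "openin T U"
      then have "{a \<in> topspace S. a \<in> U} = U"
        using topF[OF that] topS openin_subset by blast
      then show "openin S {a \<in> topspace S. a \<in> U}"
        using openS[OF that U] by simp
    qed (simp add: topF[OF that] topS)
    have "continuous_map (prod_topology S S) (topology_generated_by (\<Union>T\<in>F. {W. openin T W}))
            (\<lambda>(a, b). a \<otimes>\<^bsub>G\<^esub> b)"
      unfolding continuous_on_generated_topo_iff
    proof (intro conjI allI impI)
      fix U assume "U \<in> (\<Union>T\<in>F. {W. openin T W})"
      then obtain T where T: "T \<in> F" "openin T U" by blast
      have "continuous_map (prod_topology S S) (prod_topology T T) (\<lambda>z. (fst z, snd z))"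
        by (intro continuous_map_pairedI)
           (use continuous_map_compose[OF continuous_map_fst idS[OF T(1)]]
                continuous_map_compose[OF continuous_map_snd idS[OF T(1)]] in \<open>auto simp: o_def\<close>)
      moreover have "continuous_map (prod_topology T T) T (\<lambda>(a, b). a \<otimes>\<^bsub>G\<^esub> b)"
        using T(1) by (simp add: F_def topological_group_def)
      ultimately have "continuous_map (prod_topology S S) T ((\<lambda>(a, b). a \<otimes>\<^bsub>G\<^esub> b) \<circ> (\<lambda>z. (fst z, snd z)))"
        by (rule continuous_map_compose)
      then have "continuous_map (prod_topology S S) T (\<lambda>(a, b). a \<otimes>\<^bsub>G\<^esub> b)"
        by (simp add: o_def case_prod_unfold)
      then show "openin (prod_topology S S)
          ((\<lambda>(a, b). a \<otimes>\<^bsub>G\<^esub> b) -` U \<inter> topspace (prod_topology S S))"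
        using T(2) unfolding continuous_map_alt by blast
    next
      show "(\<lambda>(a, b). a \<otimes>\<^bsub>G\<^esub> b) ` topspace (prod_topology S S) \<subseteq> \<Union>(\<Union>T\<in>F. {W. openin T W})"
        using topS unfolding S_def topology_generated_by_topspace by auto
    qed
    moreover have "continuous_map S (topology_generated_by (\<Union>T\<in>F. {W. openin T W})) (\<lambda>a. inv\<^bsub>G\<^esub> a)"
      unfolding continuous_on_generated_topo_iff
    proof (intro conjI allI impI)
      fix U assume "U \<in> (\<Union>T\<in>F. {W. openin T W})"
      then obtain T where T: "T \<in> F" "openin T U" by blast
      have "continuous_map T T (\<lambda>a. inv\<^bsub>G\<^esub> a)"
        using T(1) by (simp add: F_def topological_group_def)
      from continuous_map_compose[OF idS[OF T(1)] this]
      show "openin S ((\<lambda>a. inv\<^bsub>G\<^esub> a) -` U \<inter> topspace S)"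
        using T(2) unfolding continuous_map_alt by (simp add: o_def)
    next
      show "(\<lambda>a. inv\<^bsub>G\<^esub> a) ` topspace S \<subseteq> \<Union>(\<Union>T\<in>F. {W. openin T W})"
        using topS unfolding S_def topology_generated_by_topspace by auto
    qed
    ultimately show ?thesis
      using assms(1) topS by (simp add: topological_group_def flip: S_def)
  qed
  ultimately show "\<exists>T. is_finest_group_topology G Q T"
    unfolding is_finest_group_topology_def using FS by (auto simp: F_def)
next
  show "T = T'" if "is_finest_group_topology G Q T" "is_finest_group_topology G Q T'" for T T'
  proof -
    have "coarser T T'" "coarser T' T"
      using that unfolding is_finest_group_topology_def by simp_all
    then show ?thesis
      unfolding topology_eq coarser_def by simp blast
  qed
qed

lemma is_finest_pi1_tau:
  assumes "x \<in> X"
  shows "is_finest_group_topology (fundamental_group X x) (pi1_qtop X x) (pi1_tau X x)"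
  unfolding pi1_tau_def
  by (rule theI') (rule ex1_finest_group_topology[OF group_fundamental_group[OF assms] topspace_pi1_qtop])

end

theory Submission
  imports Defs "HOL-Algebra.Generated_Groups"
begin

text \<open>For each open cover the subgroup \<open>N\<close> is generated by the classes of lassos, a set closed under
  conjugation, so \<open>N\<close> is normal and the unions of its cosets form a group topology in which \<open>N\<close> is
  closed. Local path connectedness gives every loop a neighbourhood in the loop space whose members
  represent a single coset, so this topology is coarser than the quotient topology, hence coarser than
  the finest group topology below it. Thus each \<open>N\<close>, and so their intersection, is closed there.\<close>

text \<open>In \<open>pi1_qtop\<close> multiplication is in general continuous only in each variable
  separately, so \<open>pi1_tau\<close> may have strictly fewer open sets, and closedness in
  \<open>pi1_qtop\<close> does not pass to \<open>pi1_tau\<close>. Moreover \<open>pi1_tau\<close>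
  is accessible only through its extremal property. Hence a whole group topology has to be exhibited
  as a competitor, not just one open set, and this is where normality enters: it makes the
  operations continuous for the coset topology. The comparison with \<open>pi1_qtop\<close> meets
  another obstacle: loops that are close in the loop space need not be homotopic, and they pass
  through different points at the subdivision times. Short connecting paths cut the gap between them
  into thin squares, each inside a member of the cover. Such a square need not be filled by a
  homotopy, but its boundary is a loop that the Spanier group of the cover absorbs.\<close>

section \<open>Coset topologies\<close>

text \<open>For a normal subgroup \<open>N\<close> this is the preimage of the discrete topology
  under the projection onto the quotient by \<open>N\<close>. Phrased as invariance under left
  translation, the family is a topology for every set \<open>N\<close>, so
  \<open>openin_coset_topology\<close> needs no premise.\<close>

definition coset_topology :: "('g, 'm) monoid_scheme \<Rightarrow> 'g set \<Rightarrow> 'g topology" where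
  "coset_topology G N =
     topology (\<lambda>W. W \<subseteq> carrier G \<and> (\<forall>h\<in>N. \<forall>a\<in>W. h \<otimes>\<^bsub>G\<^esub> a \<in> W))"

lemma openin_coset_topology:
  "openin (coset_topology G N) W \<longleftrightarrow> W \<subseteq> carrier G \<and> (\<forall>h\<in>N. \<forall>a\<in>W. h \<otimes>\<^bsub>G\<^esub> a \<in> W)"
proof -
  have "istopology (\<lambda>W. W \<subseteq> carrier G \<and> (\<forall>h\<in>N. \<forall>a\<in>W. h \<otimes>\<^bsub>G\<^esub> a \<in> W))"
    unfolding istopology_def by blast
  then show ?thesis by (simp add: coset_topology_def)
qed

context normal
begin

lemma topspace_coset_topology: "topspace (coset_topology G H) = carrier G"
proof -
  have "openin (coset_topology G H) (carrier G)"
    using subset by (auto simp: openin_coset_topology)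
  then show ?thesis
    by (metis openin_coset_topology openin_subset openin_topspace subset_antisym)
qed

lemma openin_coset_topology_r_coset:
  assumes "a \<in> carrier G"
  shows "openin (coset_topology G H) (H #> a)"
  unfolding openin_coset_topology
proof (intro conjI ballI)
  show "H #> a \<subseteq> carrier G"
    using assms subset by (rule r_coset_subset_G[rotated])
  fix h b assume "h \<in> H" "b \<in> H #> a"
  then obtain k where k: "k \<in> H" "b = k \<otimes> a" by (auto simp: r_coset_def)
  then have "h \<otimes> b = (h \<otimes> k) \<otimes> a"
    using assms \<open>h \<in> H\<close> by (simp add: m_assoc)
  then show "h \<otimes> b \<in> H #> a"
    using k \<open>h \<in> H\<close> by (auto simp: r_coset_def)
qed

text \<open>The complement of a subgroup is the union of its other cosets, hence itself invariant
  under translation.\<close>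

lemma closedin_coset_topology: "closedin (coset_topology G H) H"
proof -
  have "h \<otimes> a \<in> carrier G - H" if "h \<in> H" "a \<in> carrier G - H" for h a
  proof -
    have "a \<in> H" if "h \<otimes> a \<in> H"
    proof -
      have "inv h \<otimes> (h \<otimes> a) \<in> H"
        using that \<open>h \<in> H\<close> by blast
      then show ?thesis
        using \<open>h \<in> H\<close> \<open>a \<in> carrier G - H\<close> by (simp add: m_assoc[symmetric])
    qed
    then show ?thesis using that by auto
  qed
  then show ?thesis
    unfolding closedin_def topspace_coset_topology openin_coset_topology using subset by auto
qed

lemma topological_group_coset_topology: "topological_group G (coset_topology G H)"
proof -
  let ?T = "coset_topology G H"
  have mult: "continuous_map (prod_topology ?T ?T) ?T (\<lambda>(a, b). a \<otimes> b)"
    unfolding continuous_map_def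
  proof (intro conjI allI impI)
    fix W assume "openin ?T W"
    then have W: "W \<subseteq> carrier G" "\<And>h a. h \<in> H \<Longrightarrow> a \<in> W \<Longrightarrow> h \<otimes> a \<in> W"
      by (auto simp: openin_coset_topology)
    let ?P = "{z \<in> topspace (prod_topology ?T ?T). (case z of (a, b) \<Rightarrow> a \<otimes> b) \<in> W}"
    show "openin (prod_topology ?T ?T) ?P"
      unfolding openin_prod_topology_alt
    proof (intro allI impI)
      fix a b assume "(a, b) \<in> ?P"
      then have ab: "a \<in> carrier G" "b \<in> carrier G" "a \<otimes> b \<in> W"
        by (auto simp: topspace_coset_topology)
      have "(h \<otimes> a) \<otimes> (k \<otimes> b) \<in> W" if "h \<in> H" "k \<in> H" for h k
      proof -
        \<comment> \<open>Normality moves \<open>k\<close> past \<open>a\<close>: h a k b = h (a k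
          a^-1) (a b), so the product of the cosets of \<open>a\<close> and \<open>b\<close> stays
          in the coset of \<open>a \<otimes> b\<close>.\<close>
        have "(h \<otimes> (a \<otimes> k \<otimes> inv a)) \<otimes> (a \<otimes> b) \<in> W"
          by (rule W(2)[OF subgroup.m_closed[OF is_subgroup that(1) inv_op_closed2[OF ab(1) that(2)]] ab(3)])
        moreover have "(h \<otimes> (a \<otimes> k \<otimes> inv a)) \<otimes> (a \<otimes> b) = (h \<otimes> a) \<otimes> (k \<otimes> b)"
        proof -
          have "inv a \<otimes> (a \<otimes> b) = b"
            using ab by (simp add: m_assoc[symmetric])
          then show ?thesis using that ab by (simp add: m_assoc)
        qed
        ultimately show ?thesis by simp
      qed
      then have "(H #> a) \<times> (H #> b) \<subseteq> ?P"
        using ab by (auto simp: r_coset_def topspace_coset_topology)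
      then show "\<exists>U V. openin ?T U \<and> openin ?T V \<and> a \<in> U \<and> b \<in> V \<and> U \<times> V \<subseteq> ?P"
        using ab openin_coset_topology_r_coset rcos_self is_subgroup by meson
    qed
  qed (auto simp: topspace_coset_topology)
  have inv: "continuous_map ?T ?T (\<lambda>a. inv a)"
    unfolding continuous_map_def
  proof (intro conjI allI impI)
    fix W assume "openin ?T W"
    then have W: "\<And>h a. h \<in> H \<Longrightarrow> a \<in> W \<Longrightarrow> h \<otimes> a \<in> W"
      by (auto simp: openin_coset_topology)
    have "inv (h \<otimes> a) \<in> W" if "h \<in> H" "a \<in> carrier G" "inv a \<in> W" for h a
    proof -
      \<comment> \<open>The inverse of \<open>h \<otimes> a\<close> is a^-1 h^-1 = (a^-1 h^-1 a)
        a^-1, again a translate of \<open>inv a\<close> by an element of \<open>H\<close>.\<close>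
      have "(inv a \<otimes> inv h \<otimes> a) \<otimes> inv a \<in> W"
        using that inv_op_closed1 by (intro W) auto
      then show ?thesis using that by (simp add: m_assoc inv_mult_group)
    qed
    then show "openin ?T {a \<in> topspace ?T. inv a \<in> W}"
      by (auto simp: openin_coset_topology topspace_coset_topology)
  qed (auto simp: topspace_coset_topology)
  show ?thesis
    using mult inv topspace_coset_topology is_group by (simp add: topological_group_def)
qed

end

lemma closedin_finest_group_topology:
  assumes "is_finest_group_topology G Q T" "N \<lhd> G" "coarser (coset_topology G N) Q"
  shows "closedin T N"
proof -
  have "coarser (coset_topology G N) T"
    using assms normal.topological_group_coset_topology by (auto simp: is_finest_group_topology_def)
  then show ?thesis
    using normal.closedin_coset_topology[OF assms(2)] by (simp add: closedin_def coarser_def)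
qed

section \<open>Paths with prescribed end points\<close>

text \<open>Bundling the end points makes composability a matter of unification, so long
  concatenations are checked by chaining rules. The set argument also records that a path stays in
  one member of a cover.\<close>

definition path_in :: "'a::topological_space set \<Rightarrow> 'a \<Rightarrow> 'a \<Rightarrow> (real \<Rightarrow> 'a) \<Rightarrow> bool" where
  "path_in X a b p \<longleftrightarrow> path p \<and> path_image p \<subseteq> X \<and> pathstart p = a \<and> pathfinish p = b"

lemma loops_eq_path_in: "loops X x = {p. path_in X x x p}"
  by (simp add: loops_def path_in_def)

lemma path_in_join: "path_in X a b p \<Longrightarrow> path_in X b c q \<Longrightarrow> path_in X a c (p +++ q)"
  by (auto simp: path_in_def path_image_join)

lemma path_in_reverse: "path_in X a b p \<Longrightarrow> path_in X b a (reversepath p)"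
  by (auto simp: path_in_def)

lemma path_in_const: "a \<in> X \<Longrightarrow> path_in X a a (\<lambda>_. a)"
  by (auto simp: path_in_def path_def path_image_def pathstart_def pathfinish_def)

lemma path_in_mono: "path_in U a b p \<Longrightarrow> U \<subseteq> X \<Longrightarrow> path_in X a b p"
  by (auto simp: path_in_def)

lemma path_in_homotopic: "homotopic_paths X p q \<Longrightarrow> path_in X a b q \<Longrightarrow> path_in X a b p"
  unfolding path_in_def
  by (metis homotopic_paths_imp_path homotopic_paths_imp_subset
      homotopic_paths_imp_pathstart homotopic_paths_imp_pathfinish)

lemmas path_in_intros = path_in_join path_in_reverse

lemma path_class_eqI: "homotopic_paths X p q \<Longrightarrow> path_class X p = path_class X q"
  by (metis path_class_eq_iff homotopic_paths_imp_path homotopic_paths_imp_subset)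

section \<open>Groupoid laws up to homotopy, and lassos\<close>

lemma homotopic_assoc:
  assumes "path_in X a b p" "path_in X b c q" "path_in X c d r"
  shows "homotopic_paths X ((p +++ q) +++ r) (p +++ (q +++ r))"
  using assms unfolding path_in_def
  by (intro homotopic_paths_sym[OF homotopic_paths_assoc]) auto

lemma homotopic_join_left:
  assumes "homotopic_paths X p p'" "path_in X a b p'" "path_in X b c q"
  shows "homotopic_paths X (p +++ q) (p' +++ q)"
  using assms path_in_homotopic[OF assms(1,2)] by (intro homotopic_paths_join) (auto simp: path_in_def)

lemma homotopic_join_right:
  assumes "homotopic_paths X q q'" "path_in X a b p" "path_in X b c q'"
  shows "homotopic_paths X (p +++ q) (p +++ q')"
  using assms path_in_homotopic[OF assms(1,3)] by (intro homotopic_paths_join) (auto simp: path_in_def)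

lemma homotopic_const_left: "path_in X a b p \<Longrightarrow> homotopic_paths X ((\<lambda>_. a) +++ p) p"
  by (simp add: path_in_def homotopic_paths_const_left)

lemma homotopic_const_right: "path_in X a b p \<Longrightarrow> homotopic_paths X (p +++ (\<lambda>_. b)) p"
  by (simp add: path_in_def homotopic_paths_const_right)

lemma homotopic_reverse_left: "path_in X a b p \<Longrightarrow> homotopic_paths X (reversepath p +++ p) (\<lambda>_. b)"
  by (simp add: path_in_def homotopic_paths_reverse_left)

lemma homotopic_cancel_left:
  assumes "path_in X a b p" "path_in X b c q"
  shows "homotopic_paths X (reversepath p +++ (p +++ q)) q"
proof -
  have "homotopic_paths X (reversepath p +++ (p +++ q)) ((reversepath p +++ p) +++ q)"
    by (rule homotopic_paths_sym, rule homotopic_assoc) (use assms path_in_intros in blast)+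
  also have "homotopic_paths X \<dots> ((\<lambda>_. b) +++ q)"
  proof (rule homotopic_join_left[OF homotopic_reverse_left[OF assms(1)] _ assms(2)])
    have "b \<in> X" using assms by (auto simp: path_in_def)
    then show "path_in X b b (\<lambda>_. b)" by (rule path_in_const)
  qed
  also have "homotopic_paths X \<dots> q"
    using assms(2) by (rule homotopic_const_left)
  finally show ?thesis .
qed

text \<open>Source of normality: the conjugating loop \<open>g\<close> is absorbed into the tail,
  while \<open>v\<close>, which alone has to respect the cover, is unchanged. Apart from
  reassociation, only the equality of functions \<open>reversepath (g +++ u)\<close> =
  \<open>reversepath u +++ reversepath g\<close> is involved.\<close>

lemma homotopic_conj_lasso:
  assumes g: "path_in X x y g" and u: "path_in X y z u" and v: "path_in X z z v"
  shows "homotopic_paths X ((g +++ (u +++ v +++ reversepath u)) +++ reversepath g)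
           ((g +++ u) +++ v +++ reversepath (g +++ u))"
proof -
  note u' = path_in_reverse[OF u] and g' = path_in_reverse[OF g]
  note j = path_in_join
  have "homotopic_paths X ((g +++ (u +++ v +++ reversepath u)) +++ reversepath g)
          (g +++ ((u +++ v +++ reversepath u) +++ reversepath g))"
    by (rule homotopic_assoc[OF g j[OF u j[OF v u']] g'])
  also have "homotopic_paths X \<dots> (g +++ (u +++ ((v +++ reversepath u) +++ reversepath g)))"
    by (rule homotopic_join_right[OF homotopic_assoc[OF u j[OF v u'] g'] g
          j[OF u j[OF j[OF v u'] g']]])
  also have "homotopic_paths X \<dots> (g +++ (u +++ (v +++ (reversepath u +++ reversepath g))))"
    by (rule homotopic_join_right[OF homotopic_join_right[OF homotopic_assoc[OF v u' g'] u
          j[OF v j[OF u' g']]] g j[OF u j[OF v j[OF u' g']]]])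
  also have "homotopic_paths X \<dots> ((g +++ u) +++ (v +++ (reversepath u +++ reversepath g)))"
    by (rule homotopic_paths_sym[OF homotopic_assoc[OF g u j[OF v j[OF u' g']]]])
  also have "reversepath u +++ reversepath g = reversepath (g +++ u)"
    using g u by (simp add: path_in_def reversepath_joinpaths)
  finally show ?thesis .
qed

lemma homotopic_reverse_lasso:
  assumes u: "path_in X x z u" and v: "path_in X z z v"
  shows "homotopic_paths X (reversepath (u +++ v +++ reversepath u))
           (u +++ reversepath v +++ reversepath u)"
proof -
  have "reversepath (u +++ v +++ reversepath u) = (u +++ reversepath v) +++ reversepath u"
    using u v by (simp add: path_in_def reversepath_joinpaths)
  then show ?thesis
    using homotopic_assoc[OF u path_in_reverse[OF v] path_in_reverse[OF u]] by simp
qed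

text \<open>The loop \<open>c +++ reversepath d\<close> measures the difference of two parallel
  paths; carried back to \<open>x\<close> along \<open>u\<close>, it becomes a lasso. The
  calculation starts at the longer side, where \<open>reversepath u\<close> meets \<open>u\<close>
  and \<open>reversepath d\<close> meets \<open>d\<close>.\<close>

lemma homotopic_lasso_detour:
  assumes u: "path_in X x a u" and c: "path_in X a b c" and d: "path_in X a b d"
  shows "homotopic_paths X (u +++ c)
           ((u +++ (c +++ reversepath d) +++ reversepath u) +++ (u +++ d))"
proof -
  note u' = path_in_reverse[OF u] and d' = path_in_reverse[OF d]
  note j = path_in_join
  let ?v = "c +++ reversepath d"
  have v: "path_in X a a ?v" by (rule j[OF c d'])
  have "homotopic_paths X ((u +++ ?v +++ reversepath u) +++ (u +++ d))
          (u +++ ((?v +++ reversepath u) +++ (u +++ d)))"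
    by (rule homotopic_assoc[OF u j[OF v u'] j[OF u d]])
  also have "homotopic_paths X \<dots> (u +++ (?v +++ (reversepath u +++ (u +++ d))))"
    by (rule homotopic_join_right[OF homotopic_assoc[OF v u' j[OF u d]] u
          j[OF v j[OF u' j[OF u d]]]])
  also have "homotopic_paths X \<dots> (u +++ (?v +++ d))"
    by (rule homotopic_join_right[OF homotopic_join_right[OF homotopic_cancel_left[OF u d] v d] u
          j[OF v d]])
  also have "homotopic_paths X \<dots> (u +++ (c +++ (reversepath d +++ d)))"
    by (rule homotopic_join_right[OF homotopic_assoc[OF c d' d] u j[OF c j[OF d' d]]])
  also have "homotopic_paths X \<dots> (u +++ (c +++ (\<lambda>_. b)))"
  proof -
    have "b \<in> X" using c by (auto simp: path_in_def)
    then have k: "path_in X b b (\<lambda>_. b)" by (rule path_in_const)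
    show ?thesis
      by (rule homotopic_join_right[OF homotopic_join_right[OF homotopic_reverse_left[OF d] c k] u
            j[OF c k]])
  qed
  also have "homotopic_paths X \<dots> (u +++ c)"
    by (rule homotopic_join_right[OF homotopic_const_right[OF c] u c])
  finally show ?thesis by (rule homotopic_paths_sym)
qed

section \<open>Normality of the Spanier group of a cover\<close>

lemma inv_path_class:
  assumes "x \<in> X" "p \<in> loops X x"
  shows "inv\<^bsub>fundamental_group X x\<^esub> path_class X p = path_class X (reversepath p)"
proof -
  interpret group "fundamental_group X x"
    using assms(1) by (rule group_fundamental_group)
  have "path_class X (reversepath p +++ p) = path_class X (\<lambda>_. x)"
    using assms(2) by (intro path_class_eqI homotopic_reverse_left) (auto simp: loops_eq_path_in)
  then have "path_class X (reversepath p) \<otimes>\<^bsub>fundamental_group X x\<^esub> path_class X p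
      = \<one>\<^bsub>fundamental_group X x\<^esub>"
    using assms(2) loops_reverse[OF assms(2)]
    by (simp add: mult_path_class) (simp add: fundamental_group_def)
  moreover have "path_class X p \<in> carrier (fundamental_group X x)"
    "path_class X (reversepath p) \<in> carrier (fundamental_group X x)"
    using assms(2) loops_reverse[OF assms(2)] by (auto simp: fundamental_group_def)
  ultimately show ?thesis by (metis inv_equality)
qed

definition lasso_classes ::
    "'a::topological_space set \<Rightarrow> 'a set set \<Rightarrow> 'a \<Rightarrow> (real \<Rightarrow> 'a) set set" where
  "lasso_classes X \<U> x =
     {path_class X (u +++ v +++ reversepath u) | u v y.
        path_in X x y u \<and> path_in X y y v \<and> (\<exists>U\<in>\<U>. path_image v \<subseteq> U)}"

lemma lasso_loop: "path_in X x y u \<Longrightarrow> path_in X y y v \<Longrightarrow> u +++ v +++ reversepath u \<in> loops X x"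
  unfolding loops_eq_path_in using path_in_join path_in_reverse by blast

lemma lasso_classes_subset: "lasso_classes X \<U> x \<subseteq> carrier (fundamental_group X x)"
  using lasso_loop by (force simp: lasso_classes_def fundamental_group_def)

text \<open>Products without inverses already form the generated subgroup, because the inverse of a
  lasso class is a lasso class. In this form the subgroup laws are automatic and normality can be
  tested on generators.\<close>

lemma spanier_cover_eq_generate:
  fixes X :: "'a::topological_space set"
  assumes "x \<in> X"
  shows "spanier_cover X \<U> x = generate (fundamental_group X x) (lasso_classes X \<U> x)"
proof -
  let ?G = "fundamental_group X x" and ?L = "lasso_classes X \<U> x"
  interpret group ?G
    using assms by (rule group_fundamental_group)
  define ok where "ok = (\<lambda>(u, v). path u \<and> path_image u \<subseteq> X \<and> pathstart u = x \<and>
      v \<in> loops X (pathfinish u) \<and> (\<exists>U\<in>\<U>. path_image v \<subseteq> U))"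
  define lasso :: "(real \<Rightarrow> 'a) \<times> (real \<Rightarrow> 'a) \<Rightarrow> real \<Rightarrow> 'a"
    where "lasso = (\<lambda>(u, v). u +++ v +++ reversepath u)"
  let ?word = "\<lambda>uvs. foldr (+++) (map lasso uvs) (\<lambda>_. x)"
  let ?prod = "\<lambda>As. foldr (\<otimes>\<^bsub>?G\<^esub>) As \<one>\<^bsub>?G\<^esub>"
  have ok_iff: "ok (u, v) \<longleftrightarrow>
      (\<exists>y. path_in X x y u \<and> path_in X y y v) \<and> (\<exists>U\<in>\<U>. path_image v \<subseteq> U)" for u v
    by (auto simp: ok_def path_in_def loops_def)
  have loop: "lasso z \<in> loops X x" if "ok z" for z
    using that lasso_loop by (cases z) (auto simp: ok_iff lasso_def)
  have L: "?L = path_class X ` lasso ` {z. ok z}"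
  proof (intro subset_antisym subsetI)
    fix A assume "A \<in> ?L"
    then obtain u v where "ok (u, v)" "A = path_class X (lasso (u, v))"
      by (auto simp: lasso_classes_def ok_iff lasso_def)
    then show "A \<in> path_class X ` lasso ` {z. ok z}" by blast
  next
    fix A assume "A \<in> path_class X ` lasso ` {z. ok z}"
    then obtain u v where "ok (u, v)" "A = path_class X (lasso (u, v))" by auto
    then show "A \<in> ?L"
      unfolding lasso_classes_def ok_iff lasso_def by auto
  qed
  \<comment> \<open>Dictionary between words of paths and products of classes; the constant path
    that ends a word corresponds to the unit that ends the fold.\<close>
  have word: "?word uvs \<in> loops X x \<and>
      path_class X (?word uvs) = ?prod (map (\<lambda>z. path_class X (lasso z)) uvs)"
    if "\<forall>z\<in>set uvs. ok z" for uvs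
    using that
  proof (induction uvs)
    case Nil
    then show ?case using loops_const[OF assms] by (simp add: fundamental_group_def)
  next
    case (Cons z uvs)
    then have "?word uvs \<in> loops X x" "lasso z \<in> loops X x"
      by (auto intro: loop)
    then show ?case
      using Cons mult_path_class[of "lasso z" X x "?word uvs"] by (simp add: loops_join)
  qed
  have spanier: "A \<in> spanier_cover X \<U> x \<longleftrightarrow>
      (\<exists>As. set As \<subseteq> ?L \<and> A = ?prod As)" for A
  proof
    assume "A \<in> spanier_cover X \<U> x"
    then obtain uvs where A: "A \<in> carrier ?G" and uvs: "\<forall>z\<in>set uvs. ok z" "?word uvs \<in> A"
      unfolding spanier_cover_def ok_def lasso_def by blast
    obtain p where p: "p \<in> loops X x" "A = path_class X p"
      using A by (auto simp: fundamental_group_def)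
    then have "A = path_class X (?word uvs)"
      using uvs(2) path_class_eqI by (metis mem_Collect_eq path_class_def)
    then show "\<exists>As. set As \<subseteq> ?L \<and> A = ?prod As"
      using word[OF uvs(1)] uvs(1) L
      by (intro exI[of _ "map (\<lambda>z. path_class X (lasso z)) uvs"]) auto
  next
    assume "\<exists>As. set As \<subseteq> ?L \<and> A = ?prod As"
    then obtain As where As: "set As \<subseteq> ?L" "A = ?prod As" by blast
    have "\<exists>uvs. (\<forall>z\<in>set uvs. ok z) \<and> As = map (\<lambda>z. path_class X (lasso z)) uvs"
      using As(1)
    proof (induction As)
      case (Cons B As)
      then obtain uvs z where "\<forall>z\<in>set uvs. ok z" "As = map (\<lambda>z. path_class X (lasso z)) uvs"
        "ok z" "B = path_class X (lasso z)"
        by (auto simp: L)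
      then show ?case by (intro exI[of _ "z # uvs"]) auto
    qed simp
    then obtain uvs where uvs: "\<forall>z\<in>set uvs. ok z" "As = map (\<lambda>z. path_class X (lasso z)) uvs"
      by blast
    have "A = path_class X (?word uvs)" "?word uvs \<in> loops X x"
      using word[OF uvs(1)] uvs(2) As(2) by auto
    then have "A \<in> carrier ?G" "?word uvs \<in> A"
      by (auto simp: fundamental_group_def path_class_def loops_def)
    then show "A \<in> spanier_cover X \<U> x"
      using uvs(1) unfolding spanier_cover_def ok_def lasso_def by blast
  qed
  show ?thesis
  proof (intro subset_antisym subsetI)
    fix A assume "A \<in> spanier_cover X \<U> x"
    then obtain As where "set As \<subseteq> ?L" "A = ?prod As" using spanier by blast
    then show "A \<in> generate ?G ?L"
      by (induction As arbitrary: A) (auto intro: generate.intros)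
  next
    fix A assume "A \<in> generate ?G ?L"
    then have "\<exists>As. set As \<subseteq> ?L \<and> A = ?prod As"
    proof induction
      case one
      show ?case by (intro exI[of _ "[]"]) simp
    next
      case (incl A)
      then show ?case
        using subsetD[OF lasso_classes_subset incl] by (intro exI[of _ "[A]"]) auto
    next
      case (inv A)
      then obtain u v y where uv: "path_in X x y u" "path_in X y y v" "\<exists>U\<in>\<U>. path_image v \<subseteq> U"
        "A = path_class X (u +++ v +++ reversepath u)"
        by (auto simp: lasso_classes_def)
      have "inv\<^bsub>?G\<^esub> A = path_class X (reversepath (u +++ v +++ reversepath u))"
        using uv lasso_loop inv_path_class[OF assms] by blast
      also have "\<dots> = path_class X (u +++ reversepath v +++ reversepath u)"
        using uv by (intro path_class_eqI homotopic_reverse_lasso)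
      \<comment> \<open>Reversing \<open>v\<close> does not change its image, so the same member of
        the cover serves.\<close>
      also have "\<dots> \<in> ?L"
      proof -
        have "\<exists>U\<in>\<U>. path_image (reversepath v) \<subseteq> U" using uv(3) by simp
        then show ?thesis
          using uv(1) path_in_reverse[OF uv(2)] unfolding lasso_classes_def by blast
      qed
      finally have "inv\<^bsub>?G\<^esub> A \<in> ?L" .
      then show ?case
        using subsetD[OF lasso_classes_subset, of "inv\<^bsub>?G\<^esub> A"] by (intro exI[of _ "[inv\<^bsub>?G\<^esub> A]"]) auto
    next
      case (eng A B)
      then obtain As Bs where AB: "set As \<subseteq> ?L" "A = ?prod As" "set Bs \<subseteq> ?L" "B = ?prod Bs"
        by blast
      have closed: "?prod Cs \<in> carrier ?G" if "set Cs \<subseteq> ?L" for Cs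
        using that by (induction Cs) (auto intro: subsetD[OF lasso_classes_subset])
      have "?prod (As @ Bs) = ?prod As \<otimes>\<^bsub>?G\<^esub> ?prod Bs"
        using AB(1)
      proof (induction As)
        case Nil
        then show ?case using closed[OF AB(3)] by simp
      next
        case (Cons C As)
        then have "C \<in> carrier ?G" "set As \<subseteq> ?L" using subsetD[OF lasso_classes_subset] by auto
        then show ?case
          using Cons closed[OF AB(3)] closed[of As] by (simp add: m_assoc)
      qed
      then show ?case
        using AB by (intro exI[of _ "As @ Bs"]) auto
    qed
    then show "A \<in> spanier_cover X \<U> x" using spanier by blast
  qed
qed

lemma lasso_class_in_spanier_cover:
  assumes "x \<in> X" "path_in X x y u" "path_in X y y v" "U \<in> \<U>" "path_image v \<subseteq> U"
  shows "path_class X (u +++ v +++ reversepath u) \<in> spanier_cover X \<U> x"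
  unfolding spanier_cover_eq_generate[OF assms(1)]
  by (rule generate.incl) (use assms in \<open>auto simp: lasso_classes_def\<close>)

lemma normal_spanier_cover:
  assumes "x \<in> X"
  shows "spanier_cover X \<U> x \<lhd> fundamental_group X x"
  unfolding spanier_cover_eq_generate[OF assms]
proof (rule group.normal_generateI[OF group_fundamental_group[OF assms] lasso_classes_subset])
  let ?G = "fundamental_group X x"
  fix A B assume A: "A \<in> lasso_classes X \<U> x" and "B \<in> carrier ?G"
  then obtain g where g: "path_in X x x g" "B = path_class X g"
    by (auto simp: fundamental_group_def loops_eq_path_in)
  obtain u v y where uv: "path_in X x y u" "path_in X y y v" "\<exists>U\<in>\<U>. path_image v \<subseteq> U"
    "A = path_class X (u +++ v +++ reversepath u)"
    using A by (auto simp: lasso_classes_def)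
  have "B \<otimes>\<^bsub>?G\<^esub> A \<otimes>\<^bsub>?G\<^esub> inv\<^bsub>?G\<^esub> B
      = path_class X ((g +++ (u +++ v +++ reversepath u)) +++ reversepath g)"
    using g uv lasso_loop[OF uv(1,2)]
    by (simp add: inv_path_class assms mult_path_class loops_join loops_reverse loops_eq_path_in
        path_in_join path_in_reverse)
  also have "\<dots> = path_class X ((g +++ u) +++ v +++ reversepath (g +++ u))"
    by (rule path_class_eqI[OF homotopic_conj_lasso[OF g(1) uv(1,2)]])
  also have "\<dots> \<in> lasso_classes X \<U> x"
    using path_in_join[OF g(1) uv(1)] uv(2,3) unfolding lasso_classes_def by blast
  finally show "B \<otimes>\<^bsub>?G\<^esub> A \<otimes>\<^bsub>?G\<^esub> inv\<^bsub>?G\<^esub> B \<in> lasso_classes X \<U> x" .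
qed

section \<open>Paths that agree modulo the Spanier group of a cover\<close>

text \<open>For loops this says that the classes lie in the same coset. It is stated for arbitrary
  paths from \<open>x\<close>, as in the construction of the covering space that belongs to a
  subgroup, because the induction along a subdivision runs through initial segments, which are not
  loops.\<close>

definition spanier_rel ::
    "'a::topological_space set \<Rightarrow> 'a set set \<Rightarrow> 'a \<Rightarrow> (real \<Rightarrow> 'a) \<Rightarrow> (real \<Rightarrow> 'a) \<Rightarrow> bool" where
  "spanier_rel X \<U> x p q \<longleftrightarrow> (\<exists>y. path_in X x y q) \<and>
     (\<exists>l\<in>loops X x. path_class X l \<in> spanier_cover X \<U> x \<and> homotopic_paths X p (l +++ q))"

text \<open>The trivial loop serves as \<open>l\<close>; thus homotopies and detours can be mixed in
  one chain of \<open>spanier_rel\<close> steps.\<close>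

lemma spanier_rel_homotopic:
  assumes "homotopic_paths X p q" "path_in X x y q"
  shows "spanier_rel X \<U> x p q"
proof -
  have x: "x \<in> X" using assms(2) by (auto simp: path_in_def)
  have "path_class X (\<lambda>_. x) \<in> spanier_cover X \<U> x"
    unfolding spanier_cover_eq_generate[OF x]
    using generate.one[of "fundamental_group X x"] by (simp add: fundamental_group_def)
  moreover have "homotopic_paths X p ((\<lambda>_. x) +++ q)"
    using assms(1) homotopic_paths_sym[OF homotopic_const_left[OF assms(2)]]
    by (rule homotopic_paths_trans)
  ultimately show ?thesis
    unfolding spanier_rel_def using loops_const[OF x] assms(2) by blast
qed

lemma spanier_rel_trans [trans]:
  assumes "spanier_rel X \<U> x p q" "spanier_rel X \<U> x q r"
  shows "spanier_rel X \<U> x p r"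
proof -
  obtain y where r: "path_in X x y r" using assms(2) unfolding spanier_rel_def by blast
  then have x: "x \<in> X" by (auto simp: path_in_def)
  interpret normal "spanier_cover X \<U> x" "fundamental_group X x"
    using x by (rule normal_spanier_cover)
  obtain l m where l: "l \<in> loops X x" "path_class X l \<in> spanier_cover X \<U> x"
      "homotopic_paths X p (l +++ q)"
    and m: "m \<in> loops X x" "path_class X m \<in> spanier_cover X \<U> x"
      "homotopic_paths X q (m +++ r)"
    using assms(1,2) unfolding spanier_rel_def by blast
  have lm: "path_in X x x l" "path_in X x x m" using l(1) m(1) by (auto simp: loops_eq_path_in)
  note l(3)
  also have "homotopic_paths X (l +++ q) (l +++ (m +++ r))"
    by (rule homotopic_join_right[OF m(3) lm(1) path_in_join[OF lm(2) r]])
  also have "homotopic_paths X \<dots> ((l +++ m) +++ r)"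
    by (rule homotopic_paths_sym[OF homotopic_assoc[OF lm r]])
  finally have "homotopic_paths X p ((l +++ m) +++ r)" .
  moreover have "path_class X (l +++ m) \<in> spanier_cover X \<U> x"
    using l m m_closed by (simp flip: mult_path_class)
  ultimately show ?thesis
    unfolding spanier_rel_def using loops_join[OF l(1) m(1)] r by blast
qed

text \<open>The correcting loop \<open>l\<close> stands in front, so a path appended at the far end
  only moves brackets.\<close>

lemma spanier_rel_join:
  assumes "spanier_rel X \<U> x p q" "path_in X x y q" "path_in X y z r"
  shows "spanier_rel X \<U> x (p +++ r) (q +++ r)"
proof -
  obtain l where l: "l \<in> loops X x" "path_class X l \<in> spanier_cover X \<U> x"
      "homotopic_paths X p (l +++ q)"
    using assms(1) unfolding spanier_rel_def by blast
  have l': "path_in X x x l" using l(1) by (auto simp: loops_eq_path_in)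
  have "homotopic_paths X (p +++ r) ((l +++ q) +++ r)"
    by (rule homotopic_join_left[OF l(3) path_in_join[OF l' assms(2)] assms(3)])
  also have "homotopic_paths X \<dots> (l +++ (q +++ r))"
    by (rule homotopic_assoc[OF l' assms(2,3)])
  finally show ?thesis using l path_in_join[OF assms(2,3)] unfolding spanier_rel_def by blast
qed

text \<open>The elementary move: inside one member of the cover any path may be exchanged for any
  other with the same ends, at the cost of a single lasso with tail \<open>u\<close>.\<close>

lemma spanier_rel_detour:
  assumes "path_in X x a u" "path_in U a b c" "path_in U a b d" "U \<in> \<U>" "U \<subseteq> X"
  shows "spanier_rel X \<U> x (u +++ c) (u +++ d)"
proof -
  have x: "x \<in> X" using assms(1) by (auto simp: path_in_def)
  have cd: "path_in X a b c" "path_in X a b d"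
    using assms path_in_mono by blast+
  have v: "path_in U a a (c +++ reversepath d)"
    by (rule path_in_join[OF assms(2) path_in_reverse[OF assms(3)]])
  then have v': "path_in X a a (c +++ reversepath d)" "path_image (c +++ reversepath d) \<subseteq> U"
    using assms(5) path_in_mono by (auto simp: path_in_def)
  show ?thesis
    unfolding spanier_rel_def
    using lasso_loop[OF assms(1) v'(1)] homotopic_lasso_detour[OF assms(1) cd]
      path_in_join[OF assms(1) cd(2)] lasso_class_in_spanier_cover[OF x assms(1) v'(1) assms(4) v'(2)] by blast
qed

section \<open>Subdivision of paths\<close>

text \<open>The constant \<^const>\<open>subpath\<close> of the library requires a normed space.\<close>

definition path_segment :: "real \<Rightarrow> real \<Rightarrow> (real \<Rightarrow> 'a) \<Rightarrow> real \<Rightarrow> 'a" where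
  "path_segment a b p = (\<lambda>s. p ((b - a) * s + a))"

lemma path_in_segment:
  fixes p :: "real \<Rightarrow> 'a::topological_space"
  assumes "path p" "0 \<le> a" "a \<le> b" "b \<le> 1" "p ` {a..b} \<subseteq> U"
  shows "path_in U (p a) (p b) (path_segment a b p)"
proof -
  have range: "(b - a) * s + a \<in> {a..b}" if "s \<in> {0..1}" for s
    using that assms mult_left_le[of s "b - a"] by auto
  have "continuous_on {0..1} (\<lambda>s. p ((b - a) * s + a))"
  proof (rule continuous_on_compose2[of "{a..b}" p])
    show "continuous_on {a..b} p"
      using assms(1-4) by (auto simp: path_def intro: continuous_on_subset)
    show "continuous_on {0..1} (\<lambda>s. (b - a) * s + a)"
      by (intro continuous_intros)
  qed (use range in blast)
  then show ?thesis
    using range assms(5)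
    by (auto simp: path_in_def path_segment_def path_def path_image_def pathstart_def pathfinish_def)
qed

text \<open>Both sides traverse the same stretch of \<open>p\<close> at different speeds. Degenerate
  pieces are allowed, but the change of speed divides by \<open>b\<close>.\<close>

lemma homotopic_path_segments:
  fixes p :: "real \<Rightarrow> 'a::topological_space"
  assumes p: "path p" "path_image p \<subseteq> X" and ab: "0 \<le> a" "a \<le> b" "0 < b" "b \<le> 1"
  shows "homotopic_paths X (path_segment 0 b p) (path_segment 0 a p +++ path_segment a b p)"
proof -
  \<comment> \<open>Piecewise linear: [0,1/2] goes onto [0,a/b] and [1/2,1] onto [a/b,1], with
    common value a/b at 1/2.\<close>
  let ?f = "\<lambda>s. if s \<le> 1/2 then a / b * (2 * s) else ((b - a) * (2 * s - 1) + a) / b"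
  have X: "path_in X (p 0) (p b) (path_segment 0 b p)"
    using p ab by (intro path_in_segment) (auto simp: path_image_def)
  show ?thesis
  proof (rule homotopic_paths_reparametrize[where f = ?f])
    show "continuous_on {0..1} ?f"
    proof -
      have "continuous_on ({0..1/2} \<union> {1/2..1}) ?f"
        using ab by (intro continuous_on_cases continuous_intros) (auto simp: mult.commute[of _ 2])
      moreover have "{0..1/2} \<union> {1/2..1} = {0..1::real}" by auto
      ultimately show ?thesis by simp
    qed
    show "?f \<in> {0..1} \<rightarrow> {0..1}"
    proof
      fix s :: real assume s: "s \<in> {0..1}"
      show "?f s \<in> {0..1}"
      proof (cases "s \<le> 1/2")
        case True
        then have "a * (2 * s) \<le> b * 1"
          using s ab by (intro mult_mono) auto
        then show ?thesis using True s ab by (simp add: field_simps)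
      next
        case False
        then have "(b - a) * (2 * s - 1) \<le> b - a" "0 \<le> (b - a) * (2 * s - 1)"
          using s ab by (auto intro: mult_left_le)
        then show ?thesis using False ab by simp
      qed
    qed
    show "(path_segment 0 a p +++ path_segment a b p) s = path_segment 0 b p (?f s)" for s
      using ab by (auto simp: path_segment_def joinpaths_def)
  qed (use X ab in \<open>auto simp: path_in_def\<close>)
qed

lemma path_subdivision:
  assumes "path p" "path_image p \<subseteq> X" "open_cover X \<U>"
  obtains n :: nat where "0 < n"
    "\<And>i. i < n \<Longrightarrow> \<exists>U\<in>\<U>. p ` {real i / n..real (Suc i) / n} \<subseteq> U"
proof -
  \<comment> \<open>Preimages of members of the cover, thickened to open subsets of the line; only
    their trace on the unit interval is controlled. Intervals of length 1/n below the Lebesgue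
    number of this cover are the required pieces.\<close>
  define \<C> where "\<C> = {B. open B \<and> (\<exists>U\<in>\<U>. p ` ({0..1} \<inter> B) \<subseteq> U)}"
  have cover: "{0..1} \<subseteq> \<Union>\<C>"
  proof
    fix s :: real assume s: "s \<in> {0..1}"
    then have "p s \<in> X" using assms(2) by (auto simp: path_image_def)
    then obtain U where U: "U \<in> \<U>" "p s \<in> U" "openin (top_of_set X) U"
      using assms(3) by (auto simp: open_cover_def)
    have "openin (top_of_set {0..1}) ({0..1} \<inter> p -` U)"
      using assms(1,2) U(3)
      by (intro continuous_openin_preimage[where T = X]) (auto simp: path_def path_image_def)
    then obtain B where B: "open B" "{0..1} \<inter> p -` U = {0..1} \<inter> B"
      unfolding openin_open by blast
    then have "p ` ({0..1} \<inter> B) \<subseteq> U" by blast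
    then have "B \<in> \<C>" using U(1) B(1) unfolding \<C>_def by blast
    moreover have "s \<in> B" using U(2) s B(2) by blast
    ultimately show "s \<in> \<Union>\<C>" by blast
  qed
  then have "\<C> \<noteq> {}" by auto
  obtain \<delta> where \<delta>: "0 < \<delta>" "\<And>T. T \<subseteq> {0..1} \<Longrightarrow> diameter T < \<delta> \<Longrightarrow> \<exists>B\<in>\<C>. T \<subseteq> B"
    by (rule Lebesgue_number_lemma[OF _ \<open>\<C> \<noteq> {}\<close> cover]) (auto simp: \<C>_def)
  obtain m where "1 / real (Suc m) < \<delta>"
    using nat_approx_posE[OF \<delta>(1)] by blast
  then obtain n :: nat where n: "0 < n" "1 / real n < \<delta>" by blast
  show thesis
  proof (rule that[OF n(1)])
    fix i assume "i < n"
    let ?I = "{real i / n..real (Suc i) / n}"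
    have "real i / n \<ge> 0" "real (Suc i) / n \<le> 1" using \<open>i < n\<close> by auto
    then have I: "?I \<subseteq> {0..1}" by auto
    have "real (Suc i) / n - real i / n = 1 / n" by (simp add: add_divide_distrib)
    then have "diameter ?I < \<delta>" using n \<delta>(1) by simp
    then obtain B where "B \<in> \<C>" "?I \<subseteq> B" using \<delta>(2)[OF I] by blast
    then show "\<exists>U\<in>\<U>. p ` ?I \<subseteq> U"
      using I unfolding \<C>_def by blast
  qed
qed

section \<open>Neighbourhoods in the loop space\<close>

lemma openin_loop_space_subbasic:
  assumes "compact K" "K \<subseteq> {0..1}" "openin (top_of_set X) U"
  shows "openin (loop_space X x) {p \<in> loops X x. p ` K \<subseteq> U}"
  unfolding loop_space_def by (rule topology_generated_by_Basis) (use assms in blast)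

text \<open>Subdivide \<open>p\<close> so finely that each piece lies in a member of the cover. If \<open>q\<close> runs through the
  same members and \<open>q (t i)\<close> is joined to \<open>p (t i)\<close> by a short path \<open>\<gamma>\<close>, then \<open>q\<close> restricted to
  \<open>[0, t i]\<close> and \<open>p\<close> restricted to \<open>[0, t i]\<close> followed by \<open>\<gamma>\<close> differ by \<open>i + 1\<close> detours.\<close>

lemma spanier_rel_neighbourhood:
  assumes lpc: "locally path_connected X" and cov: "open_cover X \<U>" and p: "p \<in> loops X x"
  shows "\<exists>N. openin (loop_space X x) N \<and> p \<in> N \<and> (\<forall>q\<in>N. spanier_rel X \<U> x q p)"
proof -
  have p': "path p" "path_image p \<subseteq> X" "p 0 = x" "p 1 = x"
    using p by (auto simp: loops_def pathstart_def pathfinish_def)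
  have "x \<in> X" using p' by (auto simp: path_image_def)
  obtain n :: nat where n: "0 < n"
    and ex: "\<And>i. i < n \<Longrightarrow> \<exists>U\<in>\<U>. p ` {real i / n..real (Suc i) / n} \<subseteq> U"
    using path_subdivision[OF p'(1,2) cov] by blast
  define t where "t i = real i / n" for i
  have t: "0 \<le> t i" "t i \<le> t (Suc i)" "0 < t (Suc i)" "i \<le> n \<Longrightarrow> t i \<le> 1" "t 0 = 0" "t n = 1" for i
    using n by (auto simp: t_def divide_right_mono)
  obtain U where U: "\<And>i. i < n \<Longrightarrow> U i \<in> \<U>" "\<And>i. i < n \<Longrightarrow> p ` {t i..t (Suc i)} \<subseteq> U i"
    using ex unfolding t_def by metis
  have UX: "openin (top_of_set X) (U i)" "U i \<subseteq> X" if "i < n" for i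
    using U(1)[OF that] cov by (auto simp: open_cover_def)
  \<comment> \<open>Two nested sets with separate tasks: the open \<open>O'\<close> becomes a
    condition on \<open>q (t i)\<close>, the path connected \<open>C\<close> supplies the connecting
    path, which may leave \<open>O'\<close>.\<close>
  have "\<exists>O' C. openin (top_of_set X) O' \<and> path_connected C \<and> p (t i) \<in> O' \<and> O' \<subseteq> C \<and> C \<subseteq> X \<and>
      (i < n \<longrightarrow> C \<subseteq> U i) \<and> (\<forall>j. i = Suc j \<longrightarrow> C \<subseteq> U j)" if "i \<le> n" for i
  proof -
    \<comment> \<open>The connecting path at \<open>t i\<close> is used in the squares on both sides
      and must lie in both cover members. At the two ends one neighbour is missing, and
      \<open>X\<close> replaces it.\<close>
    let ?W = "(if i < n then U i else X) \<inter> (if 0 < i then U (i - 1) else X)"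
    have "openin (top_of_set X) ?W"
      using that UX(1)[of i] UX(1)[of "i - 1"] by (intro openin_Int) auto
    moreover have "p (t i) \<in> ?W"
    proof -
      have "p (t i) \<in> X" using p'(2) t(1)[of i] t(4)[OF that] by (auto simp: path_image_def)
      moreover have "p (t i) \<in> U i" if "i < n" using U(2)[OF that] t(2)[of i] by auto
      moreover have "p (t i) \<in> U (i - 1)" if "0 < i"
      proof -
        obtain j where "i = Suc j" using \<open>0 < i\<close> by (cases i) auto
        then show ?thesis using U(2)[of j] t(2)[of j] \<open>i \<le> n\<close> by auto
      qed
      ultimately show ?thesis by auto
    qed
    ultimately obtain O' C where "openin (top_of_set X) O'" "path_connected C" "p (t i) \<in> O'"
        "O' \<subseteq> C" "C \<subseteq> ?W"
      by (rule locallyE[OF lpc])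
    moreover have "?W \<subseteq> X" using UX(2)[of i] UX(2)[of "i - 1"] that by auto
    ultimately show ?thesis by (intro exI[of _ O'] exI[of _ C]) (auto split: if_splits)
  qed
  then obtain Q C where QC: "\<And>i. i \<le> n \<Longrightarrow>
      openin (top_of_set X) (Q i) \<and> path_connected (C i) \<and> p (t i) \<in> Q i \<and> Q i \<subseteq> C i \<and> C i \<subseteq> X \<and>
      (i < n \<longrightarrow> C i \<subseteq> U i) \<and> (\<forall>j. i = Suc j \<longrightarrow> C i \<subseteq> U j)"
    by metis
  have Q: "openin (top_of_set X) (Q i)" "p (t i) \<in> Q i" "Q i \<subseteq> C i"
    and C: "path_connected (C i)" "C i \<subseteq> X" if "i \<le> n" for i
    using QC[OF that] by auto
  have CU: "C i \<subseteq> U i" "C (Suc i) \<subseteq> U i" if "i < n" for i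
    using QC[of i] QC[of "Suc i"] that by auto
  \<comment> \<open>A finite intersection of subbasic sets: the compact sets are the closed pieces
    and the single subdivision points.\<close>
  define N where "N = (\<Inter>i\<in>{..<n}. {q \<in> loops X x. q ` {t i..t (Suc i)} \<subseteq> U i}) \<inter>
      (\<Inter>i\<in>{..n}. {q \<in> loops X x. q ` {t i} \<subseteq> Q i})"
  have "openin (loop_space X x) N"
    unfolding N_def
  proof (intro openin_Int openin_INT2)
    fix i assume "i \<in> {..<n}"
    moreover from this have "{t i..t (Suc i)} \<subseteq> {0..1}"
      using t(1)[of i] t(4)[of "Suc i"] by auto
    ultimately show "openin (loop_space X x) {q \<in> loops X x. q ` {t i..t (Suc i)} \<subseteq> U i}"
      using UX(1) by (intro openin_loop_space_subbasic) auto
  next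
    fix i assume "i \<in> {..n}"
    then show "openin (loop_space X x) {q \<in> loops X x. q ` {t i} \<subseteq> Q i}"
      using t(1,4)[of i] Q(1) by (intro openin_loop_space_subbasic) auto
  qed (use n in auto)
  moreover have "p \<in> N"
    unfolding N_def using p U(2) Q(2) by auto
  moreover have "spanier_rel X \<U> x q p" if "q \<in> N" for q
  proof -
    have q: "path q" "path_image q \<subseteq> X" "q 0 = x" "q 1 = x"
      using \<open>q \<in> N\<close> n by (auto simp: N_def loops_def pathstart_def pathfinish_def)
    have qU: "q ` {t i..t (Suc i)} \<subseteq> U i" if "i < n" for i
      using \<open>q \<in> N\<close> that by (auto simp: N_def)
    have qQ: "q (t i) \<in> Q i" if "i \<le> n" for i
      using \<open>q \<in> N\<close> that by (auto simp: N_def)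
    have init: "path_in X x (r (t i)) (path_segment 0 (t i) r)"
      if "path r" "path_image r \<subseteq> X" "r 0 = x" "i \<le> n" for r i
    proof -
      have "r ` {0..t i} \<subseteq> X"
        using that(2) t(4)[OF that(4)] by (auto simp: path_image_def)
      then show ?thesis
        using path_in_segment[of r 0 "t i" X] that(1,3) t(1)[of i] t(4)[OF that(4)] by simp
    qed
    \<comment> \<open>The path \<open>\<gamma>\<close> is kept arbitrary: the induction step applies
      the hypothesis to a path of its own choice, and at \<open>n\<close> the constant path is
      inserted.\<close>
    have "spanier_rel X \<U> x (path_segment 0 (t i) q) (path_segment 0 (t i) p +++ \<gamma>)"
      if "i \<le> n" "path_in (C i) (p (t i)) (q (t i)) \<gamma>" for i \<gamma>
      using that
    proof (induction i arbitrary: \<gamma>)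
      case 0
      have const: "path_segment 0 (t 0) r = (\<lambda>_. r 0)" for r :: "real \<Rightarrow> 'a"
        by (simp add: path_segment_def t(5))
      have k: "path_in X x x (\<lambda>_. x)" using \<open>x \<in> X\<close> by (rule path_in_const)
      have \<gamma>: "path_in (U 0) x x \<gamma>"
        using 0(2) CU(1)[OF n] by (auto simp: t(5) p' q intro: path_in_mono)
      then have "path_in (U 0) x x (\<lambda>_. x)"
        by (intro path_in_const) (auto simp: path_in_def)
      \<comment> \<open>Here \<open>\<gamma>\<close> is a loop at \<open>x\<close> inside
        \<open>U 0\<close>, so it is exchanged for the constant path by a detour with trivial
        tail.\<close>
      then have "spanier_rel X \<U> x ((\<lambda>_. x) +++ (\<lambda>_. x)) ((\<lambda>_. x) +++ \<gamma>)"
        using k \<gamma> U(1)[OF n] UX(2)[OF n] by (intro spanier_rel_detour)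
      moreover have "spanier_rel X \<U> x (\<lambda>_. x) ((\<lambda>_. x) +++ (\<lambda>_. x))"
        by (rule spanier_rel_homotopic[OF homotopic_paths_sym[OF homotopic_const_left[OF k]]
              path_in_join[OF k k]])
      ultimately have "spanier_rel X \<U> x (\<lambda>_. x) ((\<lambda>_. x) +++ \<gamma>)"
        by (metis spanier_rel_trans)
      then show ?case by (simp add: const p' q)
    next
      case (Suc i)
      then have i: "i < n" "i \<le> n" by auto
      let ?a = "p (t i)" and ?b = "q (t i)" and ?c = "p (t (Suc i))" and ?d = "q (t (Suc i))"
      let ?p = "path_segment (t i) (t (Suc i)) p" and ?q = "path_segment (t i) (t (Suc i)) q"
      let ?pa = "path_segment 0 (t i) p" and ?qa = "path_segment 0 (t i) q"
      let ?pb = "path_segment 0 (t (Suc i)) p" and ?qb = "path_segment 0 (t (Suc i)) q"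
      obtain \<beta> where "path_in (C i) ?a ?b \<beta>"
        using C(1)[OF i(2)] Q(2,3)[OF i(2)] qQ[OF i(2)] unfolding path_connected_def path_in_def
        by (meson subsetD)
      note \<beta> = this path_in_mono[OF this CU(1)[OF i(1)]] path_in_mono[OF this C(2)[OF i(2)]]
      note \<gamma> = path_in_mono[OF Suc.prems(2) CU(2)[OF i(1)]] path_in_mono[OF Suc.prems(2) C(2)[OF Suc.prems(1)]]
      have pU: "path_in (U i) ?a ?c ?p" and qU: "path_in (U i) ?b ?d ?q"
        using p'(1) q(1) t(1,2)[of i] t(4)[OF Suc.prems(1)] U(2)[OF i(1)] qU[OF i(1)]
        by (auto intro!: path_in_segment)
      note pX = path_in_mono[OF pU UX(2)[OF i(1)]] and qX = path_in_mono[OF qU UX(2)[OF i(1)]]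
      have p0: "path_in X x ?a ?pa" and q0: "path_in X x ?b ?qa"
        using init p' q i by auto
      have end_path: "path_in X x ?d (?pb +++ \<gamma>)"
        using init[OF p'(1-3) Suc.prems(1)] \<gamma>(2) by (rule path_in_join)
      have split: "homotopic_paths X (path_segment 0 (t (Suc i)) r)
          (path_segment 0 (t i) r +++ path_segment (t i) (t (Suc i)) r)"
        if "path r" "path_image r \<subseteq> X" for r
        using homotopic_path_segments[OF that t(1,2,3) t(4)[OF Suc.prems(1)]] .
      note j = path_in_join
      have "spanier_rel X \<U> x ?qb (?qa +++ ?q)"
        by (rule spanier_rel_homotopic[OF split[OF q(1,2)] j[OF q0 qX]])
      also have "spanier_rel X \<U> x (?qa +++ ?q) ((?pa +++ \<beta>) +++ ?q)"
        by (rule spanier_rel_join[OF Suc.IH[OF i(2) \<beta>(1)] j[OF p0 \<beta>(3)] qX])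
      also have "spanier_rel X \<U> x ((?pa +++ \<beta>) +++ ?q) (?pa +++ (\<beta> +++ ?q))"
        by (rule spanier_rel_homotopic[OF homotopic_assoc[OF p0 \<beta>(3) qX] j[OF p0 j[OF \<beta>(3) qX]]])
      \<comment> \<open>The square over the current piece: both ways around it lead from
        \<open>?a\<close> to \<open>?d\<close> inside \<open>U i\<close>, since \<open>C i\<close>
        and \<open>C (Suc i)\<close> lie there.\<close>
      also have "spanier_rel X \<U> x (?pa +++ (\<beta> +++ ?q)) (?pa +++ (?p +++ \<gamma>))"
        by (rule spanier_rel_detour[OF p0 j[OF \<beta>(2) qU] j[OF pU \<gamma>(1)] U(1)[OF i(1)] UX(2)[OF i(1)]])
      also have "spanier_rel X \<U> x (?pa +++ (?p +++ \<gamma>)) (?pb +++ \<gamma>)"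
      proof (rule spanier_rel_homotopic[OF homotopic_paths_trans end_path])
        show "homotopic_paths X (?pa +++ (?p +++ \<gamma>)) ((?pa +++ ?p) +++ \<gamma>)"
          by (rule homotopic_paths_sym[OF homotopic_assoc[OF p0 pX \<gamma>(2)]])
        show "homotopic_paths X ((?pa +++ ?p) +++ \<gamma>) (?pb +++ \<gamma>)"
          by (rule homotopic_join_left[OF homotopic_paths_sym[OF split[OF p'(1,2)]]
                init[OF p'(1-3) Suc.prems(1)] \<gamma>(2)])
      qed
      finally show ?case .
    qed
    \<comment> \<open>At time 1 both loops are back at \<open>x\<close>, so no connecting path is
      needed and the segments are the whole loops.\<close>
    from this[of n "\<lambda>_. x"] have "spanier_rel X \<U> x q (p +++ (\<lambda>_. x))"
      using Q(2,3)[of n] by (auto simp: t(6) p' q path_segment_def intro!: path_in_const)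
    moreover have "path_in X x x p" using p by (simp add: loops_eq_path_in)
    ultimately show ?thesis
      using spanier_rel_trans spanier_rel_homotopic homotopic_const_right by metis
  qed
  ultimately show ?thesis by blast
qed

section \<open>Comparison with the quotient topology, and closedness\<close>

lemma coarser_coset_topology_spanier_cover:
  assumes "locally path_connected X" "open_cover X \<U>" "x \<in> X"
  shows "coarser (coset_topology (fundamental_group X x) (spanier_cover X \<U> x)) (pi1_qtop X x)"
proof -
  let ?G = "fundamental_group X x" and ?H = "spanier_cover X \<U> x"
  have "openin (loop_space X x) {p \<in> loops X x. path_class X p \<in> W}"
    if W: "\<And>h a. h \<in> ?H \<Longrightarrow> a \<in> W \<Longrightarrow> h \<otimes>\<^bsub>?G\<^esub> a \<in> W" for W
  proof (rule openin_subopen[THEN iffD2, rule_format])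
    fix p assume p: "p \<in> {p \<in> loops X x. path_class X p \<in> W}"
    then have "p \<in> loops X x" by simp
    from spanier_rel_neighbourhood[OF assms(1,2) this]
    obtain N where N: "openin (loop_space X x) N" "p \<in> N"
        "\<And>q. q \<in> N \<Longrightarrow> spanier_rel X \<U> x q p"
      by auto
    \<comment> \<open>Up to homotopy \<open>q\<close> is \<open>l +++ p\<close> with the class of
      \<open>l\<close> in \<open>?H\<close>, so invariance of \<open>W\<close> under left
      translation carries membership from \<open>p\<close> to \<open>q\<close>.\<close>
    have "path_class X q \<in> W" if "q \<in> N" for q
    proof -
      obtain l where l: "l \<in> loops X x" "path_class X l \<in> ?H" "homotopic_paths X q (l +++ p)"
        using N(3)[OF \<open>q \<in> N\<close>] unfolding spanier_rel_def by blast
      then have "path_class X q = path_class X l \<otimes>\<^bsub>?G\<^esub> path_class X p"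
        using p by (simp add: mult_path_class path_class_eqI)
      then show ?thesis using W l(2) p by simp
    qed
    moreover have "N \<subseteq> loops X x"
      using openin_subset[OF N(1)] by (simp add: topspace_loop_space)
    ultimately have "N \<subseteq> {p \<in> loops X x. path_class X p \<in> W}"
      by blast
    then show "\<exists>N. openin (loop_space X x) N \<and> p \<in> N \<and> N \<subseteq> {p \<in> loops X x. path_class X p \<in> W}"
      using N(1,2) by blast
  qed
  then show ?thesis
    unfolding coarser_def
      normal.topspace_coset_topology[OF normal_spanier_cover[OF assms(3)]] topspace_pi1_qtop
      openin_coset_topology openin_pi1_qtop
    by blast
qed

theorem proposition5p1:
  fixes X :: "'a::topological_space set" and x :: 'a
  assumes "connected X" and "locally path_connected X" and "x \<in> X"
  shows "subgroup (spanier_group X x) (fundamental_group X x) \<and>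
         closedin (pi1_tau X x) (spanier_group X x)"
proof -
  interpret group "fundamental_group X x"
    using assms(3) by (rule group_fundamental_group)
  \<comment> \<open>The trivial cover makes the family nonempty; an empty intersection would not be
    a subset of the group.\<close>
  have "open_cover X {X}" by (simp add: open_cover_def)
  then have ne: "{\<U>. open_cover X \<U>} \<noteq> {}" by blast
  have "closedin (pi1_tau X x) (spanier_cover X \<U> x)" if "open_cover X \<U>" for \<U>
    by (rule closedin_finest_group_topology[OF is_finest_pi1_tau normal_spanier_cover
          coarser_coset_topology_spanier_cover]) (use assms that in auto)
  then have "closedin (pi1_tau X x) (spanier_group X x)"
    unfolding spanier_group_def using ne by (intro closedin_INT) auto
  moreover have "subgroup (spanier_group X x) (fundamental_group X x)"
    unfolding spanier_group_def
    by (rule subgroups_Inter)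
       (use ne normal_spanier_cover[OF assms(3)] normal_imp_subgroup in blast)+
  ultimately show ?thesis by blast
qed

end
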